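(* There exist topological groupoids $\Omega$ and $\Omega'$ and a morphism of groupoids (in the algebraic sense) $F:\Omega\to\Omega'$ such that $F$ is continuous on a neighborhood of the base subgroupoid $\tilde B$ in $\Omega$, but $F$ is not continuous everywhere on $\Omega$.
   Context: A groupoid $\Omega$ on a base $B$ has source projection $\alpha:\Omega\to B$, target projection $\beta:\Omega\to B$, object inclusion map $u\mapsto\tilde u$ from $B$ to $\Omega$, and a partial multiplication $xy$ defined exactly when $(x,y)\in\Omega*\Omega=\{(x,y)\in\Omega\times\Omega:\alpha(x)=\beta(y)\}$, with $\alpha(xy)=\alpha(y)$, $\beta(xy)=\beta(x)$, associativity, $\alpha(\tilde u)=\beta(\tilde u)=u$, $x\widetilde{\alpha(x)}=x$, $\widetilde{\beta(x)}x=x$, and two-sided inverses: $\alpha(x^{-1})=\beta(x)$, $\beta(x^{-1})=\alpha(x)$, $x^{-1}x=\widetilde{\alpha(x)}$, $xx^{-1}=\widetilde{\beta(x)}$. The base subgroupoid is $\tilde B=\{\tilde u:u\in B\}\subseteq\Omega$. A topological groupoid is a groupoid $\Omega$ on $B$ with topologies on $\Omega$ and $B$ such that $\alpha$, $\beta$, the object inclusion map, the inversion, and the partial multiplication (with $\Omega*\Omega$ carrying the subspace topology from $\Omega\times\Omega$) are continuous. A morphism (in the algebraic sense) $F:\Omega\to\Omega'$ is a function such that for every composable pair $(x,y)\in\Omega*\Omega$ the pair $(F(x),F(y))$ is composable in $\Omega'$ and $F(xy)=F(x)F(y)$. *)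

theory Defs
  imports "HOL-Analysis.Analysis"
begin

(* The operations are total HOL functions; only their values on the carriers
   (for the multiplication: on composable pairs) are constrained or used. *)
record ('a, 'b) groupoid =
  arrows :: "'a set"
  objects :: "'b set"
  src :: "'a \<Rightarrow> 'b"
  tgt :: "'a \<Rightarrow> 'b"
  ident :: "'b \<Rightarrow> 'a"
  mult :: "'a \<Rightarrow> 'a \<Rightarrow> 'a"
  inverse_arrow :: "'a \<Rightarrow> 'a"

definition composable :: "('a, 'b) groupoid \<Rightarrow> ('a \<times> 'a) set" where
  "composable G = {(x, y). x \<in> arrows G \<and> y \<in> arrows G \<and> src G x = tgt G y}"

(* Arrows compose from right to left: x y runs from src y to tgt x. *)
definition is_groupoid :: "('a, 'b) groupoid \<Rightarrow> bool" where
  "is_groupoid G \<longleftrightarrow>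
     src G \<in> arrows G \<rightarrow> objects G \<and>
     tgt G \<in> arrows G \<rightarrow> objects G \<and>
     ident G \<in> objects G \<rightarrow> arrows G \<and>
     inverse_arrow G \<in> arrows G \<rightarrow> arrows G \<and>
     (\<forall>(x, y) \<in> composable G.
        mult G x y \<in> arrows G \<and>
        src G (mult G x y) = src G y \<and>
        tgt G (mult G x y) = tgt G x) \<and>
     (\<forall>x y z. (x, y) \<in> composable G \<longrightarrow> (y, z) \<in> composable G \<longrightarrow>
        mult G (mult G x y) z = mult G x (mult G y z)) \<and>
     (\<forall>u \<in> objects G. src G (ident G u) = u \<and> tgt G (ident G u) = u) \<and>
     (\<forall>x \<in> arrows G.
        mult G x (ident G (src G x)) = x \<and>
        mult G (ident G (tgt G x)) x = x) \<and>
     (\<forall>x \<in> arrows G.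
        src G (inverse_arrow G x) = tgt G x \<and>
        tgt G (inverse_arrow G x) = src G x \<and>
        mult G (inverse_arrow G x) x = ident G (src G x) \<and>
        mult G x (inverse_arrow G x) = ident G (tgt G x))"

definition base_subgroupoid :: "('a, 'b) groupoid \<Rightarrow> 'a set" where
  "base_subgroupoid G = ident G ` objects G"

definition topological_groupoid ::
    "('a, 'b) groupoid \<Rightarrow> 'a topology \<Rightarrow> 'b topology \<Rightarrow> bool" where
  "topological_groupoid G T S \<longleftrightarrow>
     is_groupoid G \<and> topspace T = arrows G \<and> topspace S = objects G \<and>
     continuous_map T S (src G) \<and>
     continuous_map T S (tgt G) \<and>
     continuous_map S T (ident G) \<and>
     continuous_map T T (inverse_arrow G) \<and>
     continuous_map (subtopology (prod_topology T T) (composable G)) T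
       (\<lambda>(x, y). mult G x y)"

definition groupoid_morphism ::
    "('a, 'b) groupoid \<Rightarrow> ('c, 'd) groupoid \<Rightarrow> ('a \<Rightarrow> 'c) \<Rightarrow> bool" where
  "groupoid_morphism G H F \<longleftrightarrow>
     F \<in> arrows G \<rightarrow> arrows H \<and>
     (\<forall>(x, y) \<in> composable G.
        (F x, F y) \<in> composable H \<and> F (mult G x y) = mult H (F x) (F y))"

definition neighborhood_of :: "'a topology \<Rightarrow> 'a set \<Rightarrow> 'a set \<Rightarrow> bool" where
  "neighborhood_of T A N \<longleftrightarrow>
     N \<subseteq> topspace T \<and> (\<exists>U. openin T U \<and> A \<subseteq> U \<and> U \<subseteq> N)"

end

theory Submission
  imports Defs
begin

text \<open>
  In a trivial bundle of groups with connected fibre, every arrow is a product of arrows close to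
  the identities, and the factors can be chosen to vary continuously with the arrow; a morphism
  that is continuous near the identities is then continuous everywhere. If the fibre is
  disconnected, arrows on other sheets need not be such products, and a morphism may vary wildly
  there.

  The example is the bundle \<open>\<real> \<times> \<int>\<close> over \<open>\<real>\<close>: every
  arrow \<open>(u, n)\<close> is a loop at \<open>u\<close>, and loops at \<open>u\<close> compose by adding integers. For
  an arbitrary \<open>g :: \<real> \<rightarrow> \<int>\<close>, the map \<open>(u, n) \<mapsto> (u, n g(u))\<close> is a group
  endomorphism on each fibre, hence a morphism. The identities \<open>\<real> \<times> {0}\<close> form an
  open set, because \<open>\<int>\<close> is discrete, and there the morphism is the identity map. On the sheet
  \<open>\<real> \<times> {1}\<close> it is \<open>u \<mapsto> (u, g(u))\<close>, which is discontinuous as soon as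
  \<open>g\<close> is; the indicator function of \<open>{0}\<close> serves as \<open>g\<close>.
\<close>

definition int_bundle :: "(real \<times> real, real) groupoid" where
  "int_bundle = \<lparr>arrows = UNIV \<times> \<int>, objects = UNIV, src = fst, tgt = fst,
     ident = (\<lambda>u. (u, 0)), mult = (\<lambda>x y. (fst x, snd x + snd y)),
     inverse_arrow = (\<lambda>x. (fst x, - snd x))\<rparr>"

definition fibre_scaling :: "(real \<Rightarrow> real) \<Rightarrow> real \<times> real \<Rightarrow> real \<times> real" where
  "fibre_scaling g x = (fst x, snd x * g (fst x))"

lemma is_groupoid_int_bundle: "is_groupoid int_bundle"
  by (auto simp: is_groupoid_def int_bundle_def composable_def)

lemma topological_groupoid_int_bundle:
  "topological_groupoid int_bundle (top_of_set (UNIV \<times> \<int>)) euclidean"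
proof -
  have "continuous_on A (\<lambda>(x, y). (fst x, snd x + snd y))"
    for A :: "((real \<times> real) \<times> (real \<times> real)) set"
    unfolding case_prod_beta by (intro continuous_intros)
  moreover have "subtopology (prod_topology (top_of_set (UNIV \<times> \<int>)) (top_of_set (UNIV \<times> \<int>)))
      (composable int_bundle) = top_of_set (composable int_bundle)"
    by (auto simp: prod_topology_subtopology subtopology_subtopology composable_def int_bundle_def
        intro!: arg_cong[where f = "subtopology euclidean"])
  ultimately show ?thesis
    using is_groupoid_int_bundle
    by (auto simp: topological_groupoid_def int_bundle_def composable_def
        continuous_map_in_subtopology intro!: continuous_intros)
qed

lemma groupoid_morphism_fibre_scaling:
  assumes "range g \<subseteq> \<int>"
  shows "groupoid_morphism int_bundle int_bundle (fibre_scaling g)"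
  using assms
  by (auto simp: groupoid_morphism_def int_bundle_def composable_def fibre_scaling_def
      distrib_right image_subset_iff)

text \<open>The open strip of height less than 1 around the axis meets \<open>\<real> \<times> \<int>\<close> in the identities
  alone.\<close>

lemma openin_base_int_bundle:
  "openin (top_of_set (UNIV \<times> \<int>)) (base_subgroupoid int_bundle)"
proof -
  have "base_subgroupoid int_bundle = (UNIV \<times> \<int>) \<inter> (UNIV \<times> {-1<..<1})"
    by (auto simp: base_subgroupoid_def int_bundle_def image_iff elim!: Ints_cases)
  then show ?thesis
    by (metis openin_open open_Times open_UNIV open_greaterThanLessThan)
qed

lemma continuous_map_fibre_scaling_base:
  assumes "range g \<subseteq> \<int>"
  shows "continuous_map (subtopology (top_of_set (UNIV \<times> \<int>)) (base_subgroupoid int_bundle))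
    (top_of_set (UNIV \<times> \<int>)) (fibre_scaling g)"
proof (rule continuous_map_eq)
  show "continuous_map (subtopology (top_of_set (UNIV \<times> \<int>)) (base_subgroupoid int_bundle))
    (top_of_set (UNIV \<times> \<int>)) id"
    by (simp add: continuous_map_from_subtopology)
qed (auto simp: base_subgroupoid_def int_bundle_def fibre_scaling_def)

text \<open>Restricting to the sheet \<open>\<real> \<times> {1}\<close> and projecting to the fibre recovers
  \<open>g\<close>.\<close>

lemma continuous_of_continuous_map_fibre_scaling:
  assumes "continuous_map (top_of_set (UNIV \<times> \<int>)) (top_of_set (UNIV \<times> \<int>)) (fibre_scaling g)"
  shows "continuous_on UNIV g"
proof -
  have "continuous_on (UNIV \<times> \<int>) (fibre_scaling g)"
    using assms by auto
  then have "continuous_on UNIV (\<lambda>u. fibre_scaling g (u, 1))"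
    by (rule continuous_on_compose2) (auto intro!: continuous_intros)
  then have "continuous_on UNIV (\<lambda>u. snd (fibre_scaling g (u, 1)))"
    by (rule continuous_on_snd)
  then show ?thesis
    by (simp add: fibre_scaling_def)
qed

theorem mainTheorem1:
  "\<exists>(G :: (real \<times> real, real) groupoid) (T :: (real \<times> real) topology) (S :: real topology)
     (G' :: (real \<times> real, real) groupoid) (T' :: (real \<times> real) topology) (S' :: real topology)
     (F :: real \<times> real \<Rightarrow> real \<times> real).
     topological_groupoid G T S \<and> topological_groupoid G' T' S' \<and>
     groupoid_morphism G G' F \<and>
     (\<exists>N. neighborhood_of T (base_subgroupoid G) N \<and>
          continuous_map (subtopology T N) T' F) \<and>
     \<not> continuous_map T T' F"
proof -
  define g :: "real \<Rightarrow> real" where "g = indicator {0}"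
  let ?T = "top_of_set (UNIV \<times> \<int>) :: (real \<times> real) topology"
  have int: "range g \<subseteq> \<int>"
    by (auto simp: g_def indicator_def)
  have "\<not> isCont g 0"
    unfolding g_def isCont_indicator by (simp add: frontier_def)
  then have discont: "\<not> continuous_map ?T ?T (fibre_scaling g)"
    using continuous_of_continuous_map_fibre_scaling
    by (auto simp: continuous_on_eq_continuous_at)
  have "neighborhood_of ?T (base_subgroupoid int_bundle) (base_subgroupoid int_bundle)"
    using openin_base_int_bundle openin_subset unfolding neighborhood_of_def by blast
  then show ?thesis
    using topological_groupoid_int_bundle groupoid_morphism_fibre_scaling[OF int]
      continuous_map_fibre_scaling_base[OF int] discont by blast
qed

end
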